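(* For any (finite) tree $T$ with maximum degree $\Delta(T)$, $$\chi_{\times 2}(T)=\left\lceil\frac{\Delta(T)+1}{2}\right\rceil.$$
   Context: For a finite simple graph $G$, $N[v]=N(v)\cup\{v\}$ denotes the closed neighborhood of $v$. A set $B\subseteq V(G)$ is a $2$-limited packing ($2$LP set) if $|B\cap N[v]|\le 2$ for every $v\in V(G)$. A $2$LP partition of $G$ is a partition of $V(G)$ into $2$LP sets, and $\chi_{\times 2}(G)$ is the minimum number of sets in a $2$LP partition of $G$. *)

theory Defs
  imports "Graph_Theory.Graph_Theory" "HOL-Library.Disjoint_Sets"
begin

text \<open>
  A finite simple graph is a \<^locale>\<open>pair_graph\<close>: a finite, symmetric, loop-free digraph
  whose arcs are pairs of vertices, an edge uv being represented by both (u,v) and (v,u).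
\<close>

definition neighborhood :: "'a pair_pre_digraph \<Rightarrow> 'a \<Rightarrow> 'a set" where
  "neighborhood G v = {u. (v, u) \<in> parcs G}"

definition closed_neighborhood :: "'a pair_pre_digraph \<Rightarrow> 'a \<Rightarrow> 'a set" where
  "closed_neighborhood G v = neighborhood G v \<union> {v}"

definition degree :: "'a pair_pre_digraph \<Rightarrow> 'a \<Rightarrow> nat" where
  "degree G v = card (neighborhood G v)"

definition max_degree :: "'a pair_pre_digraph \<Rightarrow> nat" where
  "max_degree G = Max (degree G ` pverts G)"

text \<open>
  The library's \<^const>\<open>tree\<close> is unsuitable here: in a symmetric digraph every edge gives a
  directed cycle u, v, u, so no symmetric digraph with an edge is a \<^const>\<open>forest\<close>. The cycles
  of the undirected graph are the directed cycles of length at least 3. The library's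
  \<^const>\<open>connected\<close> includes that there is at least one vertex.
\<close>

definition undirected_cycle :: "'a pair_pre_digraph \<Rightarrow> ('a \<times> 'a) list \<Rightarrow> bool" where
  "undirected_cycle G p \<longleftrightarrow> pre_digraph.cycle (with_proj G) p \<and> 3 \<le> length p"

definition undirected_tree :: "'a pair_pre_digraph \<Rightarrow> bool" where
  "undirected_tree G \<longleftrightarrow>
     pair_graph G \<and> connected (with_proj G) \<and> (\<nexists>p. undirected_cycle G p)"

definition two_limited_packing :: "'a pair_pre_digraph \<Rightarrow> 'a set \<Rightarrow> bool" where
  "two_limited_packing G B \<longleftrightarrow>
     B \<subseteq> pverts G \<and> (\<forall>v \<in> pverts G. card (B \<inter> closed_neighborhood G v) \<le> 2)"

definition two_LP_partition :: "'a pair_pre_digraph \<Rightarrow> 'a set set \<Rightarrow> bool" where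
  "two_LP_partition G P \<longleftrightarrow>
     partition_on (pverts G) P \<and> (\<forall>B \<in> P. two_limited_packing G B)"

definition chi_times_2 :: "'a pair_pre_digraph \<Rightarrow> nat" where
  "chi_times_2 G = (LEAST k. \<exists>P. two_LP_partition G P \<and> card P = k)"

end

theory Submission
  imports Defs
begin

text \<open>
  Write \<open>\<Delta>\<close> for the maximum degree. Every class of a 2LP partition meets the closed neighborhood of
  a vertex of degree \<open>\<Delta>\<close> at most twice, and this neighborhood has \<open>\<Delta> + 1\<close> vertices; so there are
  at least \<open>(\<Delta> + 1) / 2\<close> classes
  (\<open>two_LP_partition_card_lower_bound\<close>).

  For the converse let \<open>k\<close> be the rounded-up half of \<open>\<Delta> + 1\<close> and colour the vertices of the tree
  with \<open>k\<close> colours, removing leaves one after the other and putting them back in reverse order.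
  When a leaf \<open>x\<close> with neighbour \<open>u\<close> is put back, the only conditions that can
  fail are those at \<open>x\<close> and at \<open>u\<close>. The one at \<open>x\<close> holds trivially, because only \<open>x\<close> and \<open>u\<close> are
  present in its closed neighborhood. As for \<open>u\<close>, at most \<open>\<Delta> \<le> 2 * k - 1\<close> vertices of
  its closed neighborhood have been coloured before \<open>x\<close>, so some colour occurs there at most once,
  and \<open>x\<close> receives that colour (\<open>acyclic_two_limited_colouring\<close>).

  Leaves are removed by shrinking a set of vertices inside a fixed graph. That a leaf always exists
  is the longest path argument (\<open>acyclic_has_leaf\<close>).
\<close>

section \<open>Leaves in acyclic graphs\<close>

lemma pcas_vwalk_arcs: "xs \<noteq> [] \<Longrightarrow> pcas (hd xs) (vwalk_arcs xs) (last xs)"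
  by (induction xs rule: vwalk_arcs.induct) auto

lemma pawalk_verts_vwalk_arcs: "xs \<noteq> [] \<Longrightarrow> pawalk_verts (hd xs) (vwalk_arcs xs) = xs"
  by (induction xs rule: vwalk_arcs.induct) auto

lemma length_vwalk_arcs: "length (vwalk_arcs xs) = length xs - 1"
  using vwalk_length_simp[of xs] unfolding vwalk_length_def .

lemma undirected_cycle_if_path_closes:
  assumes "vpath (x # as @ [y]) (with_proj G)" and "as \<noteq> []" and "(y, x) \<in> parcs G"
  shows "undirected_cycle G (vwalk_arcs (y # x # as @ [y]))"
proof -
  let ?xs = "y # x # as @ [y]"
  have "set (vwalk_arcs ?xs) \<subseteq> parcs G" and "y \<in> pverts G" and "distinct (tl ?xs)"
    using assms by (auto simp: vpath_def vwalk_def)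
  moreover have "pcas y (vwalk_arcs ?xs) y" "pawalk_verts y (vwalk_arcs ?xs) = ?xs"
    using pcas_vwalk_arcs[of ?xs] pawalk_verts_vwalk_arcs[of ?xs] by simp_all
  moreover have "3 \<le> length (vwalk_arcs ?xs)"
    using assms(2) by (cases as) (auto simp: length_vwalk_arcs simp del: vwalk_arcs.simps vwalk_arcs_Cons)
  ultimately show ?thesis
    unfolding undirected_cycle_def pre_digraph.cycle_def pre_digraph.awalk_def
      cas_with_proj_eq awalk_verts_with_proj_eq with_proj_simps
    by (metis list.size(3) not_numeral_le_zero)
qed

text \<open>
  Take a longest path with all vertices in \<open>S\<close>. By maximality every neighbour in \<open>S\<close> of its first
  vertex lies on the path, and a neighbour other than the second vertex would close a cycle. If
  the path has a single vertex, this vertex has no neighbour in \<open>S\<close> at all; the conclusion is a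
  subset of a singleton in order to cover this case.
\<close>

lemma acyclic_has_leaf:
  assumes G: "pair_graph G" and acyclic: "\<nexists>p. undirected_cycle G p"
    and S: "S \<subseteq> pverts G" "S \<noteq> {}"
  obtains x u where "x \<in> S" "neighborhood G x \<inter> S \<subseteq> {u}"
proof -
  interpret pair_graph G by (rule G)
  have fin: "finite S" using S(1) pair_finite_verts finite_subset by blast
  define P where "P xs \<longleftrightarrow> vpath xs (with_proj G) \<and> set xs \<subseteq> S" for xs
  obtain s where "s \<in> S" using S(2) by blast
  then have "P [s]" using S(1) by (auto simp: P_def vpath_def vwalk_def)
  moreover have "\<forall>xs. P xs \<longrightarrow> length xs < Suc (card S)"
    unfolding P_def vpath_def using fin by (metis card_mono distinct_card less_Suc_eq_le)
  ultimately obtain p where p: "P p" and longest: "\<And>q. P q \<Longrightarrow> length q \<le> length p"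
    using ex_has_greatest_nat[of P "[s]" length "Suc (card S)"] by blast
  have "p \<noteq> []" using p by (auto simp: P_def vpath_def vwalk_def)
  then obtain x rest where p_eq: "p = x # rest" by (cases p) auto
  have "neighborhood G x \<inter> S \<subseteq> {hd rest}"
  proof (rule subsetI, rule ccontr)
    fix y assume y: "y \<in> neighborhood G x \<inter> S" and "y \<notin> {hd rest}"
    then have xy: "(x, y) \<in> parcs G" and "y \<noteq> hd rest" by (auto simp: neighborhood_def)
    have yx: "(y, x) \<in> parcs G"
      using xy pair_sym_arcs by (auto simp: symmetric_def dest: symD)
    have "y \<in> set p"
    proof (rule ccontr)
      assume "y \<notin> set p"
      then have "P (y # p)"
        using p y yx S(1) by (auto simp: P_def p_eq vpath_def intro!: vwalk_consI)
      then show False using longest by fastforce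
    qed
    moreover have "y \<noteq> x" using xy pair_no_loops by fastforce
    ultimately obtain as bs where rest: "rest = as @ y # bs"
      unfolding p_eq by (auto dest: split_list)
    have "as \<noteq> []" using \<open>y \<noteq> hd rest\<close> rest by auto
    have "vpath (x # as @ [y]) (with_proj G)"
      using p set_vwalk_arcs_append1[of "x # as @ [y]" bs]
      unfolding P_def p_eq rest vpath_def vwalk_def by auto
    then show False
      using undirected_cycle_if_path_closes[OF _ \<open>as \<noteq> []\<close> yx] acyclic by blast
  qed
  moreover have "x \<in> S" using p by (simp add: P_def p_eq)
  ultimately show thesis by (rule that[rotated])
qed

section \<open>Colouring acyclic graphs\<close>

lemma exists_colour_used_at_most_once:
  fixes c :: "'a \<Rightarrow> nat"
  assumes "finite A" and "\<forall>a\<in>A. c a < k" and "card A < 2 * k"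
  shows "\<exists>i<k. card {a\<in>A. c a = i} \<le> 1"
proof (rule ccontr)
  assume "\<not> ?thesis"
  then have "(\<Sum>i<k. 2) \<le> (\<Sum>i<k. card {a\<in>A. c a = i})"
    by (intro sum_mono) force
  also have "\<dots> = card A"
    using sum.group[of A "{..<k}" c "\<lambda>_. 1::nat"] assms(1,2) by (simp add: image_subset_iff)
  finally show False using assms(3) by simp
qed

lemma (in pair_graph) finite_closed_neighborhood: "finite (closed_neighborhood G v)"
  by (rule finite_subset[of _ "insert v (pverts G)"])
    (auto simp: closed_neighborhood_def neighborhood_def pair_finite_verts dest: in_arcsD2)

lemma (in pair_graph) card_closed_neighborhood: "card (closed_neighborhood G v) = degree G v + 1"
proof -
  have "v \<notin> neighborhood G v" using pair_no_loops by (force simp: neighborhood_def)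
  moreover have "finite (neighborhood G v)"
    using finite_closed_neighborhood[of v] by (simp add: closed_neighborhood_def)
  ultimately show ?thesis by (simp add: closed_neighborhood_def degree_def)
qed

text \<open>
  The bound concerns the degrees in the whole graph, while a colour is only counted inside \<open>S\<close>. The
  closed neighborhood of \<open>u\<close> has at most \<open>2 * k\<close> vertices, and the leaf \<open>x\<close> about to be
  coloured is one of them: this leaves at most \<open>2 * k - 1\<close> coloured vertices near \<open>u\<close>.
\<close>

lemma acyclic_two_limited_colouring:
  assumes G: "pair_graph G" and acyclic: "\<nexists>p. undirected_cycle G p"
    and deg: "\<forall>v\<in>pverts G. degree G v + 1 \<le> 2 * k"
    and S: "S \<subseteq> pverts G"
  shows "\<exists>c :: 'a \<Rightarrow> nat. (\<forall>v\<in>S. c v < k) \<and>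
    (\<forall>v\<in>S. \<forall>i. card ({w\<in>S. c w = i} \<inter> closed_neighborhood G v) \<le> 2)"
proof -
  interpret pair_graph G by (rule G)
  have "finite S" using S pair_finite_verts finite_subset by blast
  then show ?thesis using S
  proof (induction S rule: finite_remove_induct)
    case empty
    then show ?case by simp
  next
    case (remove S)
    let ?N = "closed_neighborhood G"
    obtain x u where x: "x \<in> S" and leaf: "neighborhood G x \<inter> S \<subseteq> {u}"
      using acyclic_has_leaf[OF G acyclic remove.prems \<open>S \<noteq> {}\<close>] by blast
    define S' where "S' = S - {x}"
    obtain c where c: "\<forall>v\<in>S'. c v < k"
      and two: "\<And>v i. v \<in> S' \<Longrightarrow> card ({w\<in>S'. c w = i} \<inter> ?N v) \<le> 2"
      using remove.IH[OF x] remove.prems unfolding S'_def by blast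
    have "\<exists>i<k. u \<in> neighborhood G x \<inter> S \<longrightarrow> card ({w\<in>S'. c w = i} \<inter> ?N u) \<le> 1"
    proof (cases "u \<in> neighborhood G x \<inter> S")
      case True
      then have "x \<in> ?N u"
        using pair_sym_arcs by (auto simp: closed_neighborhood_def neighborhood_def symmetric_def dest: symD)
      then have "S' \<inter> ?N u \<subset> ?N u" by (auto simp: S'_def)
      then have "card (S' \<inter> ?N u) < card (?N u)"
        by (rule psubset_card_mono[OF finite_closed_neighborhood])
      moreover have "card (?N u) \<le> 2 * k"
        using deg True remove.prems by (auto simp: card_closed_neighborhood)
      ultimately have "card (S' \<inter> ?N u) < 2 * k" by simp
      then obtain i where "i < k" "card {w \<in> S' \<inter> ?N u. c w = i} \<le> 1"
        using exists_colour_used_at_most_once[of "S' \<inter> ?N u" c k] c finite_closed_neighborhood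
        by auto
      moreover have "{w \<in> S' \<inter> ?N u. c w = i} = {w\<in>S'. c w = i} \<inter> ?N u" by auto
      ultimately show ?thesis by auto
    next
      case False
      have "0 < k" using deg x remove.prems by fastforce
      then show ?thesis using False by blast
    qed
    then obtain i where i: "i < k"
      and once: "u \<in> neighborhood G x \<inter> S \<Longrightarrow> card ({w\<in>S'. c w = i} \<inter> ?N u) \<le> 1"
      by blast
    have "card ({w\<in>S. (c(x := i)) w = j} \<inter> ?N v) \<le> 2" if v: "v \<in> S" for v j
    proof -
      let ?new = "{w\<in>S. (c(x := i)) w = j} \<inter> ?N v" and ?old = "{w\<in>S'. c w = j} \<inter> ?N v"
      have fin: "finite ?old" using finite_closed_neighborhood by blast
      consider "v = x" | "v \<in> S'" "x \<in> ?N v" "i = j" | "v \<in> S'" "\<not> (x \<in> ?N v \<and> i = j)"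
        using v by (auto simp: S'_def)
      then show ?thesis
      proof cases
        case 1
        then have "?new \<subseteq> {x, u}" using leaf by (auto simp: closed_neighborhood_def)
        then have "card ?new \<le> card {x, u}" by (rule card_mono[rotated]) simp
        also have "\<dots> \<le> 2" by (simp add: card_insert_if)
        finally show ?thesis .
      next
        case 2
        then have "v \<in> neighborhood G x \<inter> S"
          using pair_sym_arcs v
          by (auto simp: S'_def closed_neighborhood_def neighborhood_def symmetric_def dest: symD)
        then have "card ?old \<le> 1" using leaf once \<open>i = j\<close> by blast
        moreover have "?new \<subseteq> insert x ?old" by (auto simp: S'_def split: if_splits)
        then have "card ?new \<le> card (insert x ?old)" using fin by (intro card_mono) auto
        moreover have "card (insert x ?old) \<le> card ?old + 1" using fin by (simp add: card_insert_if)
        ultimately show ?thesis by linarith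
      next
        case 3
        then have "?new \<subseteq> ?old" by (auto simp: S'_def split: if_splits)
        then have "card ?new \<le> card ?old" by (rule card_mono[OF fin])
        then show ?thesis using two[OF \<open>v \<in> S'\<close>, of j] by linarith
      qed
    qed
    moreover have "\<forall>v\<in>S. (c(x := i)) v < k" using c i by (auto simp: S'_def)
    ultimately show ?case by blast
  qed
qed

section \<open>Bounds on the size of a 2LP partition\<close>

lemma two_LP_partition_card_lower_bound:
  assumes G: "pair_graph G" and P: "two_LP_partition G P" and v: "v \<in> pverts G"
  shows "degree G v + 1 \<le> 2 * card P"
proof -
  interpret pair_graph G by (rule G)
  let ?N = "closed_neighborhood G v"
  have part: "partition_on (pverts G) P" using P by (simp add: two_LP_partition_def)
  have "finite P" using finite_elements[OF pair_finite_verts part] .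
  have "?N \<subseteq> pverts G"
    using v by (auto simp: closed_neighborhood_def neighborhood_def dest: in_arcsD2)
  then have "?N = (\<Union>B\<in>P. B \<inter> ?N)" using partition_onD1[OF part] by auto
  then have "card ?N \<le> (\<Sum>B\<in>P. card (B \<inter> ?N))"
    using card_UN_le[OF \<open>finite P\<close>, of "\<lambda>B. B \<inter> ?N"] by simp
  also have "\<dots> \<le> (\<Sum>B\<in>P. 2)"
    using P v by (intro sum_mono) (auto simp: two_LP_partition_def two_limited_packing_def)
  finally show ?thesis by (simp add: card_closed_neighborhood)
qed

text \<open>
  The partition consists of the nonempty colour classes. It may have fewer than \<open>k\<close>
  members, hence the inequality.
\<close>

lemma acyclic_two_LP_partition:
  assumes G: "pair_graph G" and acyclic: "\<nexists>p. undirected_cycle G p"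
    and deg: "\<forall>v\<in>pverts G. degree G v + 1 \<le> 2 * k"
  obtains P where "two_LP_partition G P" "card P \<le> k"
proof -
  let ?V = "pverts G"
  obtain c :: "'a \<Rightarrow> nat" where c: "\<forall>v\<in>?V. c v < k"
    and two: "\<forall>v\<in>?V. \<forall>i. card ({w\<in>?V. c w = i} \<inter> closed_neighborhood G v) \<le> 2"
    using acyclic_two_limited_colouring[OF assms order_refl] by blast
  define P where "P = (\<lambda>i. {w\<in>?V. c w = i}) ` c ` ?V"
  have "partition_on ?V P"
    by (rule partition_onI) (auto simp: P_def disjnt_def)
  moreover have "\<forall>B\<in>P. two_limited_packing G B"
    using two by (auto simp: P_def two_limited_packing_def)
  ultimately have "two_LP_partition G P" by (simp add: two_LP_partition_def)
  moreover have "card P \<le> k"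
  proof -
    have sub: "c ` ?V \<subseteq> {..<k}" using c by auto
    then have "card P \<le> card (c ` ?V)"
      unfolding P_def by (intro card_image_le finite_subset[OF sub]) simp
    also have "\<dots> \<le> k" using card_mono[OF _ sub] by simp
    finally show ?thesis .
  qed
  ultimately show thesis by (rule that)
qed

theorem theorem3p1:
  fixes T :: "'a pair_pre_digraph"
  assumes "undirected_tree T"
  shows "int (chi_times_2 T) = \<lceil>(real (max_degree T) + 1) / 2\<rceil>"
proof -
  have G: "pair_graph T" and acyclic: "\<nexists>p. undirected_cycle T p" and "connected (with_proj T)"
    using assms by (auto simp: undirected_tree_def)
  interpret pair_graph T by (rule G)
  have "pverts T \<noteq> {}"
    using \<open>connected (with_proj T)\<close> by (auto simp: connected_def strongly_connected_def)
  then have "max_degree T \<in> degree T ` pverts T"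
    unfolding max_degree_def using pair_finite_verts by (intro Max_in) auto
  then obtain v where v: "v \<in> pverts T" "degree T v = max_degree T" by auto
  have max: "degree T w \<le> max_degree T" if "w \<in> pverts T" for w
    unfolding max_degree_def using that pair_finite_verts by simp
  \<comment> \<open>Truncating division rounds the half of \<open>\<Delta> + 1\<close> up once 1 is added to the numerator.\<close>
  define k where "k = (max_degree T + 2) div 2"
  have "\<forall>w\<in>pverts T. degree T w + 1 \<le> 2 * k"
    using max by (fastforce simp: k_def)
  then obtain P where P: "two_LP_partition T P" "card P \<le> k"
    using acyclic_two_LP_partition[OF G acyclic] by blast
  have "k \<le> card Q" if "two_LP_partition T Q" for Q
    using two_LP_partition_card_lower_bound[OF G that v(1)] v(2) by (simp add: k_def)
  then have "chi_times_2 T = k"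
    unfolding chi_times_2_def using P by (intro Least_equality) (auto intro: le_antisym)
  moreover have "\<lceil>(real (max_degree T) + 1) / 2\<rceil> = int k"
  proof (rule ceiling_unique)
    have "2 * k \<le> max_degree T + 2" "max_degree T + 1 \<le> 2 * k" by (auto simp: k_def)
    then have "real (2 * k) \<le> real (max_degree T + 2)" "real (max_degree T + 1) \<le> real (2 * k)"
      by (simp_all only: of_nat_le_iff)
    then show "real_of_int (int k) - 1 < (real (max_degree T) + 1) / 2"
      and "(real (max_degree T) + 1) / 2 \<le> real_of_int (int k)" by auto
  qed
  ultimately show ?thesis by simp
qed

end
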